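(* Let $\mathcal H$, $A$, $B$, $L$ be as in the context, and suppose that $A$ or $B$ is $\mu$-strongly monotone for some $\mu>0$. Let $p$ be the unique point of $(A+B)^{-1}(0)$. Let $\alpha\in\,]1/2,1]$ and $a>0$, and let $(x_n)$ be generated by the stochastic forward-backward-forward algorithm described in the context, with step sizes $$\lambda_n=\frac{4a}{\mu n^{\alpha}}\qquad(n\ge1)$$ (and $\lambda_0>0$ arbitrary). Suppose that there exist constants $c$ and $\theta>1$ such that $$(\forall n\in\mathbb N)\quad \mathsf E\big[2\|r_n-Bw_n\|^2+\|s_n-By_n\|^2\,\big|\,\mathcal F_n\big]\le c\ \text{ a.s.}$$ and $\epsilon_n=\mathcal O(n^{-\theta})$. Set $\beta=\min\{2\alpha,\theta\}$ and assume that $a\le\beta$. Then $$\mathsf E[\|x_n-p\|^2]=\begin{cases}\mathcal O(n^{\alpha-\beta}) & \text{if } 1/2<\alpha<1,\\ \mathcal O(n^{-a})+\mathcal O(n^{1-\beta}) & \text{if }\alpha=1,\ a\ne\beta-1,\\ \mathcal O(n^{-a})+\mathcal O\big(\frac{\ln n}{n^a}\big) & \text{if }\alpha=1,\ a=\beta-1.\end{cases}$$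
   Context: $\mathcal H$ is a separable real Hilbert space with inner product $\langle\cdot\mid\cdot\rangle$ and norm $\|\cdot\|$; all random variables are defined on a probability space, and $\mathsf E[\cdot\,|\,\cdot]$ denotes conditional expectation. Standing assumptions: $B:\mathcal H\to\mathcal H$ is monotone and $L$-Lipschitz continuous with $L>0$; $A:\mathcal H\to2^{\mathcal H}$ is maximally monotone; the solution set $(A+B)^{-1}(0)=\{x\in\mathcal H: 0\in Ax+Bx\}$ is nonempty. An operator $T:\mathcal H\to2^{\mathcal H}$ is $\mu$-strongly monotone ($\mu>0$) if $\langle x-y\mid u-v\rangle\ge\mu\|x-y\|^2$ for all $u\in Tx$, $v\in Ty$. Algorithm. Fix $\bar\theta\in[0,1]$, a positive real sequence $(\lambda_n)_{n\in\mathbb N}$, and a sequence $(\epsilon_n)_{n\in\mathbb N}\subset[0,+\infty)$ with $\sum_{n=0}^{\infty}\epsilon_n<+\infty$. Let $x_{-1},x_0$ be $\mathcal H$-valued square integrable random variables. For each $n\ge0$: set $$\alpha_n=\min\Big\{\frac{\epsilon_n}{\|x_n-x_{n-1}\|},\bar\theta\Big\}\ \text{if }x_n\ne x_{n-1},\qquad \alpha_n=\bar\theta\ \text{if }x_n=x_{n-1};$$ let $r_n$ be an $\mathcal H$-valued random vector and set $$w_n=x_n+\alpha_n(x_n-x_{n-1}),\qquad y_n=(\mathrm{Id}+\lambda_nA)^{-1}(w_n-\lambda_nr_n);$$ let $s_n$ be an $\mathcal H$-valued random vector with $\mathsf E[s_n|\mathcal F_n]=By_n$, where $\mathcal F_n=\sigma(x_{-1},x_0,r_0,x_1,r_1,\ldots,x_n,r_n)$;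 and set $x_{n+1}=y_n-\lambda_n(s_n-r_n)$. *)

theory Defs
  imports "HOL-Probability.Probability" "HOL-Library.Landau_Symbols"
begin

text \<open>A set-valued operator on \<open>'a\<close> is a function \<open>'a \<Rightarrow> 'a set\<close>; a single-valued \<open>B\<close> is
  regarded as the operator \<open>\<lambda>x. {B x}\<close>.\<close>

definition monotone_operator :: "('a::real_inner \<Rightarrow> 'a set) \<Rightarrow> bool" where
  "monotone_operator T \<longleftrightarrow>
     (\<forall>x y. \<forall>u\<in>T x. \<forall>v\<in>T y. inner (x - y) (u - v) \<ge> 0)"

definition maximally_monotone :: "('a::real_inner \<Rightarrow> 'a set) \<Rightarrow> bool" where
  "maximally_monotone T \<longleftrightarrow>
     monotone_operator T \<and> (\<forall>S. monotone_operator S \<and> (\<forall>x. T x \<subseteq> S x) \<longrightarrow> S = T)"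

definition strongly_monotone :: "real \<Rightarrow> ('a::real_inner \<Rightarrow> 'a set) \<Rightarrow> bool" where
  "strongly_monotone \<mu> T \<longleftrightarrow>
     (\<forall>x y. \<forall>u\<in>T x. \<forall>v\<in>T y. inner (x - y) (u - v) \<ge> \<mu> * (norm (x - y))\<^sup>2)"

definition zeros_sum :: "('a::real_inner \<Rightarrow> 'a set) \<Rightarrow> ('a \<Rightarrow> 'a) \<Rightarrow> 'a set" where
  "zeros_sum A B = {x. 0 \<in> {u + B x |u. u \<in> A x}}"

text \<open>The inverse \<open>(Id + l A)\<^sup>-\<^sup>1\<close>, as an inverse of set-valued operators. For maximally
  monotone \<open>A\<close> and \<open>l > 0\<close> its values are singletons.\<close>

definition resolvent :: "('a::real_inner \<Rightarrow> 'a set) \<Rightarrow> real \<Rightarrow> 'a \<Rightarrow> 'a set" where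
  "resolvent A l z = {y. z \<in> {y + l *\<^sub>R u |u. u \<in> A y}}"

definition inertial_weight :: "real \<Rightarrow> real \<Rightarrow> 'a::real_normed_vector \<Rightarrow> 'a \<Rightarrow> real" where
  "inertial_weight \<theta>bar e x x' =
     (if x \<noteq> x' then min (e / norm (x - x')) \<theta>bar else \<theta>bar)"

text \<open>The predecessor of the \<open>n\<close>-th term of a sequence starting at index \<open>-1\<close>; the term of
  index \<open>-1\<close> is kept separately as \<open>xm\<close>.\<close>

definition prev :: "'b \<Rightarrow> (nat \<Rightarrow> 'b) \<Rightarrow> nat \<Rightarrow> 'b" where
  "prev xm x n = (case n of 0 \<Rightarrow> xm | Suc k \<Rightarrow> x k)"

definition sigma_generated :: "'w measure \<Rightarrow> ('w \<Rightarrow> 'a::topological_space) set \<Rightarrow> 'w measure" where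
  "sigma_generated M Xs =
     sigma (space M) {X -` S \<inter> space M |X S. X \<in> Xs \<and> S \<in> sets borel}"

definition fbf_history ::
  "'w measure \<Rightarrow> ('w \<Rightarrow> 'a::topological_space) \<Rightarrow> (nat \<Rightarrow> 'w \<Rightarrow> 'a) \<Rightarrow> (nat \<Rightarrow> 'w \<Rightarrow> 'a) \<Rightarrow> nat
    \<Rightarrow> 'w measure" where
  "fbf_history M xm x r n = sigma_generated M ({xm} \<union> x ` {..n} \<union> r ` {..n})"

text \<open>\<open>is_cond_exp M F X Y\<close>: \<open>Y\<close> is a version of the conditional expectation of the integrable
  vector-valued random variable \<open>X\<close> given \<open>F\<close>. The library's \<open>real_cond_exp\<close> covers only
  real-valued random variables.\<close>

definition is_cond_exp ::
  "'w measure \<Rightarrow> 'w measure \<Rightarrow> ('w \<Rightarrow> 'a::{banach, second_countable_topology}) \<Rightarrow> ('w \<Rightarrow> 'a)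
    \<Rightarrow> bool" where
  "is_cond_exp M F X Y \<longleftrightarrow>
     subalgebra M F \<and> integrable M X \<and> integrable M Y \<and> Y \<in> borel_measurable F \<and>
     (\<forall>S\<in>sets F. set_lebesgue_integral M S X = set_lebesgue_integral M S Y)"

end

theory Submission
  imports Defs
begin

text \<open>
  Let \<open>e n = E \<parallel>x n - p\<parallel>\<^sup>2\<close>. Expanding \<open>\<parallel>x (n + 1) - p\<parallel>\<^sup>2\<close> and using the strong monotonicity of
  \<open>A + B\<close> gives a contraction of \<open>\<parallel>w n - p\<parallel>\<^sup>2\<close> by \<open>1 - \<mu> \<lambda> n\<close>, up to a variance term of order
  \<open>(\<lambda> n)\<^sup>2\<close> and an inner product of \<open>s n - B (y n)\<close> with a vector measurable for the past, whose
  expectation vanishes. The inertial displacement is at most \<open>\<epsilon> n\<close>, so for large \<open>n\<close>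
  \<open>e (n + 1) \<le> (1 - 2 a / n powr \<alpha>) e n + C / n powr \<beta>\<close>, and the rates follow by comparing \<open>e\<close> with
  multiples of \<open>n powr - q\<close>. Square integrability of the \<open>x n\<close> propagates along the recursion since
  resolvents are nonexpansive and \<open>p\<close> is the resolvent of \<open>p - \<lambda> n B p\<close>.
\<close>

section \<open>A Chung-type recursion\<close>

lemma powr_Suc_lower_bound:
  fixes q :: real
  assumes "0 \<le> q" "n \<ge> 1"
  shows "real n powr (- q) * (1 - q / real n) \<le> real (Suc n) powr (- q)"
proof -
  have n: "real n > 0" using assms by simp
  have "1 - q / real n \<le> 1 + (- q) * ln (1 + 1 / real n)"
    using mult_left_mono[OF ln_add_one_self_le_self[of "1 / real n"] assms(1)] n by simp
  also have "\<dots> \<le> exp ((- q) * ln (1 + 1 / real n))" by (rule exp_ge_add_one_self)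
  also have "\<dots> = (1 + 1 / real n) powr (- q)"
    using add_pos_pos[of 1 "1 / real n"] n by (simp add: powr_def)
  finally have "real n powr (- q) * (1 - q / real n)
      \<le> real n powr (- q) * (1 + 1 / real n) powr (- q)"
    by (intro mult_left_mono) auto
  also have "\<dots> = (real n * (1 + 1 / real n)) powr (- q)"
    using n by (simp add: powr_mult)
  also have "real n * (1 + 1 / real n) = real (Suc n)" using n by (simp add: field_simps)
  finally show ?thesis .
qed

lemma chung_recursion_bigo:
  fixes e :: "nat \<Rightarrow> real"
  assumes nonneg: "\<And>n. e n \<ge> 0" and a: "a > 0" and \<alpha>: "\<alpha> > 0" and q: "q \<ge> 0" "q + \<alpha> \<le> \<beta>"
    and C: "C \<ge> 0"
    and slow: "eventually (\<lambda>n. q / real n \<le> a * real n powr (- \<alpha>)) sequentially"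
    and rec: "eventually (\<lambda>n. e (Suc n) \<le> (1 - 2 * a * real n powr (- \<alpha>)) * e n
                + C * real n powr (- \<beta>)) sequentially"
  shows "e \<in> O(\<lambda>n. real n powr (- q))"
proof -
  have "(\<lambda>n. real n powr (- \<alpha>)) \<longlonglongrightarrow> 0"
    using \<alpha> by (intro tendsto_neg_powr filterlim_real_sequentially) auto
  hence "eventually (\<lambda>n. real n powr (- \<alpha>) < 1 / (2 * a)) sequentially"
    using a by (intro order_tendstoD) auto
  hence "eventually (\<lambda>n. 2 * a * real n powr (- \<alpha>) \<le> 1) sequentially"
    by eventually_elim (use a in \<open>simp add: field_simps\<close>)
  from eventually_conj[OF slow eventually_conj[OF rec this]] obtain N0 where N0: "\<And>n. n \<ge> N0 \<Longrightarrow> q / real n \<le> a * real n powr (- \<alpha>)"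
    "\<And>n. n \<ge> N0 \<Longrightarrow> e (Suc n) \<le> (1 - 2 * a * real n powr (- \<alpha>)) * e n + C * real n powr (- \<beta>)"
    "\<And>n. n \<ge> N0 \<Longrightarrow> 2 * a * real n powr (- \<alpha>) \<le> 1"
    unfolding eventually_sequentially by blast
  define N where "N = max N0 1"
  define K where "K = max (C / a) (e N * real N powr q)"
  have N: "N \<ge> 1" "N \<ge> N0" by (auto simp: N_def)
  have "C = C / a * a" using a by simp
  also have "\<dots> \<le> K * a" using a by (intro mult_right_mono) (auto simp: K_def)
  finally have K: "K \<ge> 0" "C \<le> K * a" "e N * real N powr q \<le> K"
    using C a by (auto simp: K_def le_max_iff_disj)
  have bound: "e n \<le> K * real n powr (- q)" if "n \<ge> N" for n
    using that
  proof (induction n rule: dec_induct)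
    case base
    show ?case using K(3) N by (simp add: powr_minus field_simps)
  next
    case (step n)
    have n: "n \<ge> 1" "n \<ge> N0" using step N by auto
    have "C * real n powr (- \<beta>) \<le> (K * a) * real n powr (- q - \<alpha>)"
      using n q K C by (intro mult_mono powr_mono) auto
    hence C': "C * real n powr (- \<beta>) \<le> K * real n powr (- q) * (a * real n powr (- \<alpha>))"
      by (simp add: powr_diff powr_minus field_simps)
    have "e (Suc n) \<le> (1 - 2 * a * real n powr (- \<alpha>)) * e n + C * real n powr (- \<beta>)"
      using N0(2) n by blast
    also have "\<dots> \<le> (1 - 2 * a * real n powr (- \<alpha>)) * (K * real n powr (- q))
        + K * real n powr (- q) * (a * real n powr (- \<alpha>))"
      using N0(3)[OF n(2)] by (intro add_mono mult_left_mono step.IH C') auto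
    also have "\<dots> = K * (real n powr (- q) * (1 - a * real n powr (- \<alpha>)))"
      by (simp add: algebra_simps)
    also have "\<dots> \<le> K * (real n powr (- q) * (1 - q / real n))"
      using N0(1)[OF n(2)] K by (intro mult_left_mono) auto
    also have "\<dots> \<le> K * real (Suc n) powr (- q)"
      by (intro mult_left_mono powr_Suc_lower_bound q n K)
    finally show ?case .
  qed
  show ?thesis
  proof (rule bigoI)
    show "eventually (\<lambda>n. norm (e n) \<le> K * norm (real n powr (- q))) sequentially"
      using eventually_ge_at_top[of N] by eventually_elim (use bound nonneg in auto)
  qed
qed

section \<open>Square integrable random vectors\<close>

definition square_integrable :: "'w measure \<Rightarrow> ('w \<Rightarrow> 'a::{real_inner, second_countable_topology}) \<Rightarrow> bool"
  where "square_integrable M X \<longleftrightarrow>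
    X \<in> borel_measurable M \<and> integrable M (\<lambda>\<omega>. (norm (X \<omega>))\<^sup>2)"

lemma norm_add_power2_le: "(norm (u + v))\<^sup>2 \<le> 2 * (norm u)\<^sup>2 + 2 * (norm (v::'a::real_normed_vector))\<^sup>2"
proof -
  have "(norm (u + v))\<^sup>2 \<le> (norm u + norm v)\<^sup>2"
    by (intro power_mono norm_triangle_ineq) auto
  also have "\<dots> \<le> 2 * (norm u)\<^sup>2 + 2 * (norm v)\<^sup>2"
    using zero_le_power2[of "norm u - norm v"] by (simp add: power2_eq_square algebra_simps)
  finally show ?thesis .
qed

lemma square_integrable_bound:
  assumes "square_integrable M X" "Y \<in> borel_measurable M"
    and "\<And>\<omega>. \<omega> \<in> space M \<Longrightarrow> norm (Y \<omega>) \<le> C * norm (X \<omega>)"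
  shows "square_integrable M Y"
proof -
  have int: "integrable M (\<lambda>\<omega>. C\<^sup>2 * (norm (X \<omega>))\<^sup>2)"
    using assms(1) by (auto simp: square_integrable_def)
  have "(norm (Y \<omega>))\<^sup>2 \<le> C\<^sup>2 * (norm (X \<omega>))\<^sup>2" if "\<omega> \<in> space M" for \<omega>
    using power_mono[OF assms(3)[OF that], of 2] by (simp add: power_mult_distrib)
  hence "integrable M (\<lambda>\<omega>. (norm (Y \<omega>))\<^sup>2)"
    using assms(2) by (intro Bochner_Integration.integrable_bound[OF int]) (auto intro!: AE_I2)
  with assms(2) show ?thesis by (simp add: square_integrable_def)
qed

lemma square_integrable_add:
  assumes "square_integrable M X" "square_integrable M Y"
  shows "square_integrable M (\<lambda>\<omega>. X \<omega> + Y \<omega>)"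
proof -
  have int: "integrable M (\<lambda>\<omega>. 2 * (norm (X \<omega>))\<^sup>2 + 2 * (norm (Y \<omega>))\<^sup>2)"
    using assms by (auto simp: square_integrable_def)
  have [measurable]: "X \<in> borel_measurable M" "Y \<in> borel_measurable M"
    using assms by (auto simp: square_integrable_def)
  have "integrable M (\<lambda>\<omega>. (norm (X \<omega> + Y \<omega>))\<^sup>2)"
    by (intro Bochner_Integration.integrable_bound[OF int]) (auto intro!: AE_I2 norm_add_power2_le)
  thus ?thesis by (simp add: square_integrable_def)
qed

lemma square_integrable_scaleR:
  assumes "square_integrable M X"
  shows "square_integrable M (\<lambda>\<omega>. k *\<^sub>R X \<omega>)"
  using assms by (auto simp: square_integrable_def power_mult_distrib)

lemma square_integrable_diff:
  assumes "square_integrable M X" "square_integrable M Y"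
  shows "square_integrable M (\<lambda>\<omega>. X \<omega> - Y \<omega>)"
  using square_integrable_add[OF assms(1) square_integrable_scaleR[OF assms(2), of "-1"]] by simp

lemma (in finite_measure) square_integrable_const: "square_integrable M (\<lambda>_. v)"
  by (simp add: square_integrable_def)

lemma square_integrable_cong:
  assumes "\<And>\<omega>. \<omega> \<in> space M \<Longrightarrow> X \<omega> = Y \<omega>"
  shows "square_integrable M X \<longleftrightarrow> square_integrable M Y"
  unfolding square_integrable_def
  by (intro conj_cong measurable_cong Bochner_Integration.integrable_cong) (auto simp: assms)

lemma square_integrable_lipschitz:
  fixes B :: "'a::{real_inner, second_countable_topology} \<Rightarrow> 'b::{real_inner, second_countable_topology}"
  assumes M: "finite_measure M" and B: "L-lipschitz_on UNIV B" and X: "square_integrable M X"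
  shows "square_integrable M (\<lambda>\<omega>. B (X \<omega>))"
proof -
  interpret finite_measure M by fact
  have cont: "continuous_on UNIV B" using B by (rule lipschitz_on_continuous_on)
  have [measurable]: "X \<in> borel_measurable M" using X by (simp add: square_integrable_def)
  have "square_integrable M (\<lambda>\<omega>. B (X \<omega>) - B 0)"
  proof (rule square_integrable_bound[OF X, where C = L])
    show "(\<lambda>\<omega>. B (X \<omega>) - B 0) \<in> borel_measurable M"
      using borel_measurable_continuous_onI[OF cont] by measurable
    show "norm (B (X \<omega>) - B 0) \<le> L * norm (X \<omega>)" for \<omega>
      using lipschitz_onD[OF B, of "X \<omega>" 0] by (simp add: dist_norm)
  qed
  from square_integrable_add[OF this square_integrable_const[of "B 0"]] show ?thesis by simp
qed

lemma integrable_norm_mult_norm: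
  assumes "square_integrable M X" "square_integrable M Y"
  shows "integrable M (\<lambda>\<omega>. norm (X \<omega>) * norm (Y \<omega>))"
proof -
  have int: "integrable M (\<lambda>\<omega>. (norm (X \<omega>))\<^sup>2 + (norm (Y \<omega>))\<^sup>2)"
    using assms by (auto simp: square_integrable_def)
  have [measurable]: "X \<in> borel_measurable M" "Y \<in> borel_measurable M"
    using assms by (auto simp: square_integrable_def)
  have "norm u * norm v \<le> (norm u)\<^sup>2 + (norm v)\<^sup>2" for u :: 'b and v :: 'c
    using sum_squares_bound[of "norm u" "norm v"] mult_nonneg_nonneg[OF norm_ge_zero norm_ge_zero, of u v]
    by linarith
  thus ?thesis
    by (intro Bochner_Integration.integrable_bound[OF int]) (auto intro!: AE_I2)
qed

lemma (in prob_space) expectation_norm_add_le: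
  assumes "square_integrable M X" "square_integrable M Y"
    and "\<And>\<omega>. \<omega> \<in> space M \<Longrightarrow> norm (Y \<omega> - X \<omega>) \<le> e"
  shows "expectation (\<lambda>\<omega>. (norm (Y \<omega>))\<^sup>2)
    \<le> (1 + e) * expectation (\<lambda>\<omega>. (norm (X \<omega>))\<^sup>2) + e + e\<^sup>2"
proof -
  have pw: "(norm (Y \<omega>))\<^sup>2 \<le> (1 + e) * (norm (X \<omega>))\<^sup>2 + (e + e\<^sup>2)" if "\<omega> \<in> space M" for \<omega>
  proof -
    have e: "e \<ge> 0" using assms(3)[OF that] norm_ge_zero order_trans by blast
    have "norm (Y \<omega>) \<le> norm (X \<omega>) + e"
      using norm_triangle_ineq[of "X \<omega>" "Y \<omega> - X \<omega>"] assms(3)[OF that] by simp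
    hence "(norm (Y \<omega>))\<^sup>2 \<le> (norm (X \<omega>) + e)\<^sup>2" by (intro power_mono) auto
    also have "\<dots> = (norm (X \<omega>))\<^sup>2 + e * (2 * norm (X \<omega>)) + e\<^sup>2"
      by (simp add: power2_eq_square algebra_simps)
    also have "\<dots> \<le> (norm (X \<omega>))\<^sup>2 + e * ((norm (X \<omega>))\<^sup>2 + 1) + e\<^sup>2"
      using e sum_squares_bound[of "norm (X \<omega>)" 1] by (intro add_mono mult_left_mono) auto
    finally show ?thesis by (simp add: algebra_simps)
  qed
  have "expectation (\<lambda>\<omega>. (norm (Y \<omega>))\<^sup>2)
      \<le> expectation (\<lambda>\<omega>. (1 + e) * (norm (X \<omega>))\<^sup>2 + (e + e\<^sup>2))"
    using assms pw by (intro integral_mono) (auto simp: square_integrable_def)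
  also have "\<dots> = (1 + e) * expectation (\<lambda>\<omega>. (norm (X \<omega>))\<^sup>2) + e + e\<^sup>2"
    using assms by (simp add: square_integrable_def prob_space)
  finally show ?thesis .
qed

lemma is_cond_exp_orthogonal:
  fixes X Y Z :: "'w \<Rightarrow> 'a::{real_inner, banach, second_countable_topology}"
  assumes ce: "is_cond_exp M F X Y" and Z: "Z \<in> borel_measurable F"
    and int: "integrable M (\<lambda>\<omega>. norm (X \<omega> - Y \<omega>) * norm (Z \<omega>))"
  shows "(\<integral>\<omega>. inner (X \<omega> - Y \<omega>) (Z \<omega>) \<partial>M) = 0"
proof -
  define D where "D \<omega> = X \<omega> - Y \<omega>" for \<omega>
  have sub: "subalgebra M F" and D: "integrable M D"
    using ce by (auto simp: is_cond_exp_def D_def[abs_def])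
  have sp: "space F = space M" using sub by (simp add: subalgebra_def)
  have D0: "set_lebesgue_integral M S D = 0" "set_integrable M S D" if "S \<in> sets F" for S
  proof -
    have S: "S \<in> sets M" using sub that by (auto simp: subalgebra_def)
    hence *: "set_integrable M S X" "set_integrable M S Y"
      using ce unfolding is_cond_exp_def set_integrable_def
      by (auto intro!: integrable_mult_indicator)
    show "set_lebesgue_integral M S D = 0"
      using ce that set_integral_diff(2)[OF *] by (simp add: is_cond_exp_def D_def[abs_def])
    show "set_integrable M S D"
      using set_integral_diff(1)[OF *] by (simp add: D_def[abs_def])
  qed
  obtain G where G: "\<And>i. simple_function F (G i)" "\<And>\<omega>. \<omega> \<in> space F \<Longrightarrow> (\<lambda>i. G i \<omega>) \<longlonglongrightarrow> Z \<omega>"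
    "\<And>i \<omega>. \<omega> \<in> space F \<Longrightarrow> norm (G i \<omega>) \<le> 2 * norm (Z \<omega>)"
    using borel_measurable_implies_sequence_metric[OF Z, of 0] by (auto simp: dist_norm) metis
  have meas: "D \<in> borel_measurable M" "Z \<in> borel_measurable M" "\<And>i. G i \<in> borel_measurable M"
    using D measurable_from_subalg[OF sub Z]
      measurable_from_subalg[OF sub borel_measurable_simple_function[OF G(1)]] by auto
  have zero: "(\<integral>\<omega>. inner (D \<omega>) (G i \<omega>) \<partial>M) = 0" for i
  proof -
    let ?S = "\<lambda>v. G i -` {v} \<inter> space F"
    have fin: "finite (G i ` space F)" and S: "\<And>v. v \<in> G i ` space F \<Longrightarrow> ?S v \<in> sets F"
      using G(1)[of i] by (auto simp: simple_function_def)
    have "inner (D \<omega>) (G i \<omega>) = (\<Sum>v\<in>G i ` space F. inner (indicator (?S v) \<omega> *\<^sub>R D \<omega>) v)"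
      if "\<omega> \<in> space M" for \<omega>
    proof -
      have "(\<Sum>v\<in>G i ` space F. inner (indicator (?S v) \<omega> *\<^sub>R D \<omega>) v)
          = (\<Sum>v\<in>G i ` space F. if v = G i \<omega> then inner (D \<omega>) v else 0)"
        using that sp by (intro sum.cong) (auto simp: indicator_def)
      thus ?thesis using that fin sp by (simp add: sum.delta)
    qed
    hence "(\<integral>\<omega>. inner (D \<omega>) (G i \<omega>) \<partial>M)
        = (\<integral>\<omega>. (\<Sum>v\<in>G i ` space F. inner (indicator (?S v) \<omega> *\<^sub>R D \<omega>) v) \<partial>M)"
      by (intro Bochner_Integration.integral_cong) auto
    also have "\<dots> = (\<Sum>v\<in>G i ` space F. (\<integral>\<omega>. inner (indicator (?S v) \<omega> *\<^sub>R D \<omega>) v \<partial>M))"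
      using D0(2)[OF S] by (intro Bochner_Integration.integral_sum integrable_inner_left)
        (auto simp: set_integrable_def)
    also have "\<dots> = (\<Sum>v\<in>G i ` space F. inner (set_lebesgue_integral M (?S v) D) v)"
      using D0(2)[OF S] unfolding set_lebesgue_integral_def set_integrable_def
      by (intro sum.cong integral_inner_left) auto
    also have "\<dots> = 0" using D0(1)[OF S] by simp
    finally show ?thesis .
  qed
  have "(\<lambda>i. \<integral>\<omega>. inner (D \<omega>) (G i \<omega>) \<partial>M) \<longlonglongrightarrow> (\<integral>\<omega>. inner (D \<omega>) (Z \<omega>) \<partial>M)"
  proof (rule integral_dominated_convergence)
    show "integrable M (\<lambda>\<omega>. 2 * (norm (D \<omega>) * norm (Z \<omega>)))" using int by (simp add: D_def)
    show "AE \<omega> in M. (\<lambda>i. inner (D \<omega>) (G i \<omega>)) \<longlonglongrightarrow> inner (D \<omega>) (Z \<omega>)"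
      using G(2) sp by (auto intro!: AE_I2 tendsto_inner)
    show "AE \<omega> in M. norm (inner (D \<omega>) (G i \<omega>)) \<le> 2 * (norm (D \<omega>) * norm (Z \<omega>))" for i
    proof (rule AE_I2)
      fix \<omega> assume "\<omega> \<in> space M"
      hence "norm (D \<omega>) * norm (G i \<omega>) \<le> norm (D \<omega>) * (2 * norm (Z \<omega>))"
        using G(3) sp by (intro mult_left_mono) auto
      thus "norm (inner (D \<omega>) (G i \<omega>)) \<le> 2 * (norm (D \<omega>) * norm (Z \<omega>))"
        using Cauchy_Schwarz_ineq2[of "D \<omega>" "G i \<omega>"] by simp
    qed
  qed (use meas in measurable)
  hence "(\<integral>\<omega>. inner (D \<omega>) (Z \<omega>) \<partial>M) = 0" by (simp add: zero LIMSEQ_const_iff)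
  thus ?thesis by (simp add: D_def)
qed

section \<open>Monotone operators and resolvents\<close>

lemma resolventE:
  assumes "y \<in> resolvent A l z"
  obtains u where "u \<in> A y" "z = y + l *\<^sub>R u"
  using assms by (auto simp: resolvent_def)

lemma resolvent_nonexpansive:
  assumes A: "monotone_operator A" and l: "l \<ge> 0"
    and y: "y \<in> resolvent A l z" "y' \<in> resolvent A l z'"
  shows "norm (y - y') \<le> norm (z - z')"
proof -
  obtain u u' where u: "u \<in> A y" "z = y + l *\<^sub>R u" "u' \<in> A y'" "z' = y' + l *\<^sub>R u'"
    using y by (metis resolventE)
  have "0 \<le> l * inner (y - y') (u - u')"
    using A u l by (auto simp: monotone_operator_def)
  hence "(norm (y - y'))\<^sup>2 \<le> inner (y - y') (z - z')"
    by (simp add: u power2_norm_eq_inner algebra_simps)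
  also have "\<dots> \<le> norm (y - y') * norm (z - z')" by (rule norm_cauchy_schwarz)
  finally show ?thesis by (cases "y = y'") (auto simp: power2_eq_square)
qed

text \<open>The domain of the resolvent need not be known to be Borel: preimages under the selection
  \<open>y\<close> are taken relative to it. In particular Minty's theorem is not needed.\<close>

lemma resolvent_measurable:
  fixes A :: "'a::{real_inner, second_countable_topology} \<Rightarrow> 'a set"
  assumes A: "monotone_operator A" and l: "l \<ge> 0" and z: "z \<in> borel_measurable F"
    and y: "\<And>\<omega>. \<omega> \<in> space F \<Longrightarrow> y \<omega> \<in> resolvent A l (z \<omega>)"
  shows "y \<in> borel_measurable F"
proof -
  define D where "D = {v. resolvent A l v \<noteq> {}}"
  define J where "J v = (SOME u. u \<in> resolvent A l v)" for v
  have J: "J v \<in> resolvent A l v" if "v \<in> D" for v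
    using that unfolding J_def D_def by (auto intro: someI)
  have "1-lipschitz_on D J"
    by (intro lipschitz_onI) (auto simp: dist_norm intro!: resolvent_nonexpansive[OF A l] J)
  hence "J \<in> borel_measurable (restrict_space borel D)"
    by (intro borel_measurable_continuous_on_restrict lipschitz_on_continuous_on)
  moreover have zD: "z \<omega> \<in> D" if "\<omega> \<in> space F" for \<omega> using y[OF that] by (auto simp: D_def)
  hence "z \<in> measurable F (restrict_space borel D)"
    using z by (intro measurable_restrict_space2) auto
  ultimately have "(\<lambda>\<omega>. J (z \<omega>)) \<in> borel_measurable F" by measurable
  moreover have "J (z \<omega>) = y \<omega>" if "\<omega> \<in> space F" for \<omega>
    using resolvent_nonexpansive[OF A l J[OF zD[OF that]] y[OF that]] by simp
  ultimately show ?thesis by (subst measurable_cong[where g = "\<lambda>\<omega>. J (z \<omega>)"]) auto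
qed

lemma strongly_monotone_sum:
  assumes "monotone_operator A" "monotone_operator (\<lambda>z. {B z})"
    and "strongly_monotone \<mu> A \<or> strongly_monotone \<mu> (\<lambda>z. {B z})"
    and "u \<in> A y" "v \<in> A z"
  shows "inner (y - z) ((u + B y) - (v + B z)) \<ge> \<mu> * (norm (y - z))\<^sup>2"
proof -
  have "inner (y - z) ((u + B y) - (v + B z)) = inner (y - z) (u - v) + inner (y - z) (B y - B z)"
    by (simp add: inner_simps)
  moreover have "inner (y - z) (u - v) \<ge> 0" "inner (y - z) (B y - B z) \<ge> 0"
    using assms by (auto simp: monotone_operator_def)
  moreover have "inner (y - z) (u - v) \<ge> \<mu> * (norm (y - z))\<^sup>2
      \<or> inner (y - z) (B y - B z) \<ge> \<mu> * (norm (y - z))\<^sup>2"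
    using assms by (auto simp: strongly_monotone_def)
  ultimately show ?thesis by linarith
qed

lemma mem_zeros_sum_iff: "z \<in> zeros_sum A B \<longleftrightarrow> - B z \<in> A z"
  by (auto simp: zeros_sum_def add_eq_0_iff2 eq_commute[of 0])

lemma zeros_sum_eq_singleton:
  assumes "monotone_operator A" "monotone_operator (\<lambda>z. {B z})" "\<mu> > 0"
    and "strongly_monotone \<mu> A \<or> strongly_monotone \<mu> (\<lambda>z. {B z})"
    and "p \<in> zeros_sum A B"
  shows "zeros_sum A B = {p}"
proof -
  have "z = p" if "z \<in> zeros_sum A B" for z
  proof -
    have "\<mu> * (norm (z - p))\<^sup>2 \<le> 0"
      using strongly_monotone_sum[OF assms(1,2,4), of "- B z" z "- B p" p] that assms(5)
      by (simp add: mem_zeros_sum_iff)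
    hence "(norm (z - p))\<^sup>2 \<le> 0" using assms(3) by (simp add: mult_le_0_iff)
    thus ?thesis by simp
  qed
  thus ?thesis using assms(5) by blast
qed

section \<open>One step of the algorithm\<close>

lemma inertial_weight_measurable:
  fixes x x' :: "'w \<Rightarrow> 'a::{real_normed_vector, second_countable_topology}"
  assumes [measurable]: "x \<in> borel_measurable F" "x' \<in> borel_measurable F"
  shows "(\<lambda>\<omega>. inertial_weight \<theta> e (x \<omega>) (x' \<omega>)) \<in> borel_measurable F"
  unfolding inertial_weight_def by measurable

lemma inertial_weight_displacement:
  assumes "e \<ge> 0" "\<theta> \<ge> 0"
  shows "norm (inertial_weight \<theta> e x x' *\<^sub>R (x - x')) \<le> e"
proof (cases "x = x'")
  case False
  hence n: "norm (x - x') > 0" by simp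
  have "\<bar>min (e / norm (x - x')) \<theta>\<bar> = min (e / norm (x - x')) \<theta>"
    using assms by (auto simp: min_def)
  also have "\<dots> \<le> e / norm (x - x')" by simp
  finally have "\<bar>min (e / norm (x - x')) \<theta>\<bar> * norm (x - x') \<le> e" using n by (simp add: field_simps)
  thus ?thesis using False by (simp only: inertial_weight_def norm_scaleR if_True simp_thms)
qed (use assms in auto)

lemma fbf_step_estimate:
  fixes w y p r s x'' :: "'a::real_inner"
  assumes B: "L-lipschitz_on UNIV B"
    and mono: "inner (y - p) ((u + B y) - (- B p + B p)) \<ge> \<mu> * (norm (y - p))\<^sup>2"
    and l: "l > 0" "\<mu> > 0" "2 * l\<^sup>2 * L\<^sup>2 + 2 * l * \<mu> \<le> 1"
    and u: "w - l *\<^sub>R r = y + l *\<^sub>R u" and x'': "x'' = y - l *\<^sub>R (s - r)"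
  shows "(norm (x'' - p))\<^sup>2 \<le> (1 - l * \<mu>) * (norm (w - p))\<^sup>2
    + l\<^sup>2 * (2 * (norm (r - B w))\<^sup>2 + (norm (s - B y))\<^sup>2)
    + inner (s - B y) ((2 * l\<^sup>2) *\<^sub>R (B y - r) - (2 * l) *\<^sub>R (y - p))"
proof -
  define d where "d = y - p"
  define h where "h = B y - r"
  define g where "g = s - B y"
  have wy: "w - y = l *\<^sub>R (u + r)" using u by (simp add: algebra_simps)
  have "w - p = d + l *\<^sub>R (u + r)" using wy by (simp add: d_def algebra_simps)
  hence wp: "(norm (w - p))\<^sup>2 = (norm d)\<^sup>2 + 2 * l * inner d (u + r) + (norm (w - y))\<^sup>2"
    unfolding wy by (simp add: power2_norm_eq_inner inner_simps inner_commute algebra_simps)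
  have xp: "x'' - p = d - l *\<^sub>R (g + h)" by (simp add: x'' d_def g_def h_def)
  have "(norm (x'' - p))\<^sup>2 = (norm d)\<^sup>2 - 2 * l * inner d (g + h)
      + l\<^sup>2 * ((norm g)\<^sup>2 + (norm h)\<^sup>2 + 2 * inner g h)"
    unfolding xp by (simp add: power2_norm_eq_inner inner_simps inner_commute algebra_simps
        power2_eq_square[of l])
  also have "\<dots> = (norm (w - p))\<^sup>2 - (norm (w - y))\<^sup>2 - 2 * l * inner d (u + B y)
      + l\<^sup>2 * ((norm g)\<^sup>2 + (norm h)\<^sup>2) + inner g ((2 * l\<^sup>2) *\<^sub>R h - (2 * l) *\<^sub>R d)"
    unfolding wp by (simp add: h_def inner_simps inner_commute algebra_simps)
  finally have id: "(norm (x'' - p))\<^sup>2 = (norm (w - p))\<^sup>2 - (norm (w - y))\<^sup>2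
      - 2 * l * inner d (u + B y) + l\<^sup>2 * ((norm g)\<^sup>2 + (norm h)\<^sup>2)
      + inner g ((2 * l\<^sup>2) *\<^sub>R h - (2 * l) *\<^sub>R d)" .
  have "(norm h)\<^sup>2 \<le> 2 * (norm (B y - B w))\<^sup>2 + 2 * (norm (B w - r))\<^sup>2"
    using norm_add_power2_le[of "B y - B w" "B w - r"] by (simp add: h_def)
  moreover have "(norm (B y - B w))\<^sup>2 \<le> (L * norm (w - y))\<^sup>2"
    using lipschitz_onD[OF B, of y w] by (intro power_mono) (auto simp: dist_norm norm_minus_commute)
  ultimately have "(norm h)\<^sup>2 \<le> 2 * L\<^sup>2 * (norm (w - y))\<^sup>2 + 2 * (norm (r - B w))\<^sup>2"
    by (simp add: power_mult_distrib norm_minus_commute)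
  hence h: "l\<^sup>2 * (norm h)\<^sup>2 \<le> l\<^sup>2 * (2 * L\<^sup>2 * (norm (w - y))\<^sup>2 + 2 * (norm (r - B w))\<^sup>2)"
    by (intro mult_left_mono) auto
  have m: "l * inner d (u + B y) \<ge> l * (\<mu> * (norm d)\<^sup>2)"
    using mono l by (intro mult_left_mono) (auto simp: d_def)
  have "(norm (w - p))\<^sup>2 \<le> 2 * (norm (w - y))\<^sup>2 + 2 * (norm d)\<^sup>2"
    using norm_add_power2_le[of "w - y" d] by (simp add: d_def)
  hence t: "l * \<mu> * (norm (w - p))\<^sup>2 \<le> l * \<mu> * (2 * (norm (w - y))\<^sup>2 + 2 * (norm d)\<^sup>2)"
    using l by (intro mult_left_mono) auto
  have k: "(2 * l\<^sup>2 * L\<^sup>2 + 2 * l * \<mu>) * (norm (w - y))\<^sup>2 \<le> 1 * (norm (w - y))\<^sup>2"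
    using l by (intro mult_right_mono) auto
  show ?thesis
    unfolding id using h m t k by (simp add: d_def g_def h_def algebra_simps)
qed

lemma nn_cond_exp_bound_integral:
  fixes f :: "'w \<Rightarrow> real"
  assumes M: "prob_space M" and F: "subalgebra M F" and f: "f \<in> borel_measurable M" "\<And>\<omega>. f \<omega> \<ge> 0"
    and bd: "AE \<omega> in M. nn_cond_exp M F (\<lambda>\<omega>. ennreal (f \<omega>)) \<omega> \<le> ennreal c"
  shows "integrable M f" "(\<integral>\<omega>. f \<omega> \<partial>M) \<le> max c 0"
proof -
  interpret prob_space M by fact
  interpret finite_measure_subalgebra M F by unfold_locales (rule F)
  have "(\<integral>\<^sup>+\<omega>. ennreal (f \<omega>) \<partial>M) = (\<integral>\<^sup>+\<omega>. nn_cond_exp M F (\<lambda>\<omega>. ennreal (f \<omega>)) \<omega> \<partial>M)"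
    using nn_cond_exp_intg[of "\<lambda>_. 1" "\<lambda>\<omega>. ennreal (f \<omega>)"] f(1) by simp
  also have "\<dots> \<le> (\<integral>\<^sup>+\<omega>. ennreal c \<partial>M)" by (rule nn_integral_mono_AE[OF bd])
  also have "\<dots> = ennreal (max c 0)" by (simp add: emeasure_space_1 ennreal_max_0 max.commute)
  finally have le: "(\<integral>\<^sup>+\<omega>. ennreal (f \<omega>) \<partial>M) \<le> ennreal (max c 0)" .
  show "integrable M f"
    using f le by (intro integrableI_bounded) (auto simp: order_le_less_trans[OF le])
  hence "ennreal (\<integral>\<omega>. f \<omega> \<partial>M) \<le> ennreal (max c 0)"
    using le f by (subst nn_integral_eq_integral[symmetric]) auto
  thus "(\<integral>\<omega>. f \<omega> \<partial>M) \<le> max c 0" by (subst (asm) ennreal_le_iff) auto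
qed

lemma fbf_step_expectation:
  fixes M F :: "'w measure" and A :: "'a::{real_inner, banach, second_countable_topology} \<Rightarrow> 'a set"
    and x x' x'' r s w y :: "'w \<Rightarrow> 'a"
  assumes M: "prob_space M" and B: "L-lipschitz_on UNIV B"
    and mono: "monotone_operator A" "monotone_operator (\<lambda>z. {B z})"
    and strong: "strongly_monotone \<mu> A \<or> strongly_monotone \<mu> (\<lambda>z. {B z})"
    and \<mu>: "\<mu> > 0" and p: "p \<in> zeros_sum A B" and par: "\<theta> \<ge> 0" "e \<ge> 0" "l > 0"
    and meas: "x \<in> borel_measurable F" "x' \<in> borel_measurable F" "r \<in> borel_measurable F"
      "s \<in> borel_measurable M"
    and x: "square_integrable M x"
    and w: "\<And>\<omega>. \<omega> \<in> space M \<Longrightarrow>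
      w \<omega> = x \<omega> + inertial_weight \<theta> e (x \<omega>) (x' \<omega>) *\<^sub>R (x \<omega> - x' \<omega>)"
    and y: "\<And>\<omega>. \<omega> \<in> space M \<Longrightarrow> y \<omega> \<in> resolvent A l (w \<omega> - l *\<^sub>R r \<omega>)"
    and ce: "is_cond_exp M F s (\<lambda>\<omega>. B (y \<omega>))"
    and x'': "\<And>\<omega>. \<omega> \<in> space M \<Longrightarrow> x'' \<omega> = y \<omega> - l *\<^sub>R (s \<omega> - r \<omega>)"
    and bd: "AE \<omega> in M. nn_cond_exp M F
      (\<lambda>\<omega>. ennreal (2 * (norm (r \<omega> - B (w \<omega>)))\<^sup>2 + (norm (s \<omega> - B (y \<omega>)))\<^sup>2)) \<omega> \<le> ennreal c"
  shows "square_integrable M x''"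
    and "2 * l\<^sup>2 * L\<^sup>2 + 2 * l * \<mu> \<le> 1 \<Longrightarrow> (\<integral>\<omega>. (norm (x'' \<omega> - p))\<^sup>2 \<partial>M)
      \<le> (1 - l * \<mu>) * ((1 + e) * (\<integral>\<omega>. (norm (x \<omega> - p))\<^sup>2 \<partial>M) + e + e\<^sup>2) + l\<^sup>2 * max c 0"
proof -
  interpret prob_space M by fact
  have sub: "subalgebra M F" using ce by (simp add: is_cond_exp_def)
  hence sp: "space F = space M" by (simp add: subalgebra_def)
  note [measurable] = meas inertial_weight_measurable[OF meas(1,2)]
  have wF: "w \<in> borel_measurable F"
    by (subst measurable_cong[OF w]) (auto simp: sp)
  note [measurable] = wF
  have yF: "y \<in> borel_measurable F"
    by (rule resolvent_measurable[OF mono(1), of l "\<lambda>\<omega>. w \<omega> - l *\<^sub>R r \<omega>"]) (use par y sp in auto)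
  note [measurable] = yF
  have BF[measurable]: "B \<in> borel_measurable borel"
    using B by (intro borel_measurable_continuous_onI lipschitz_on_continuous_on)
  have [measurable]: "w \<in> borel_measurable M" "y \<in> borel_measurable M" "r \<in> borel_measurable M"
    "x \<in> borel_measurable M"
    by (rule measurable_from_subalg[OF sub], fact)+

  have disp: "norm (w \<omega> - x \<omega>) \<le> e" if "\<omega> \<in> space M" for \<omega>
    using inertial_weight_displacement[OF par(2,1)] w[OF that] by simp
  have "square_integrable M (\<lambda>\<omega>. w \<omega> - x \<omega>)"
    by (rule square_integrable_bound[OF square_integrable_const[of "1::real"], where C = e])
      (auto simp: disp)
  from square_integrable_add[OF this x] have W: "square_integrable M w" by simp

  define G where "G \<omega> = 2 * (norm (r \<omega> - B (w \<omega>)))\<^sup>2 + (norm (s \<omega> - B (y \<omega>)))\<^sup>2" for \<omega>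
  have G: "integrable M G" "expectation G \<le> max c 0"
    using nn_cond_exp_bound_integral[OF M sub, of G c] bd unfolding G_def by auto
  have rB: "square_integrable M (\<lambda>\<omega>. r \<omega> - B (w \<omega>))"
    unfolding square_integrable_def
    by (intro conjI Bochner_Integration.integrable_bound[OF G(1)] AE_I2) (auto simp: G_def)
  have sB: "square_integrable M (\<lambda>\<omega>. s \<omega> - B (y \<omega>))"
    unfolding square_integrable_def
    by (intro conjI Bochner_Integration.integrable_bound[OF G(1)] AE_I2) (auto simp: G_def)
  note fin = finite_measure_axioms
  from square_integrable_add[OF rB square_integrable_lipschitz[OF fin B W]]
  have R: "square_integrable M r" by simp
  have pres: "p \<in> resolvent A l (p - l *\<^sub>R B p)"
    using p by (auto simp: resolvent_def mem_zeros_sum_iff intro!: exI[of _ "- B p"])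
  have "square_integrable M (\<lambda>\<omega>. y \<omega> - p)"
  proof (rule square_integrable_bound[where C = 1])
    show "square_integrable M (\<lambda>\<omega>. w \<omega> - l *\<^sub>R r \<omega> - (p - l *\<^sub>R B p))"
      by (intro square_integrable_diff square_integrable_scaleR W R square_integrable_const)
  qed (use resolvent_nonexpansive[OF mono(1) _ y pres] par in auto)
  note Yp = this
  from square_integrable_add[OF Yp square_integrable_const[of p]]
  have Y: "square_integrable M y" by simp
  from square_integrable_add[OF sB square_integrable_lipschitz[OF fin B Y]]
  have S: "square_integrable M s" by simp
  have "square_integrable M (\<lambda>\<omega>. y \<omega> - l *\<^sub>R (s \<omega> - r \<omega>))"
    by (intro square_integrable_diff square_integrable_scaleR Y S R)
  thus X'': "square_integrable M x''" by (subst square_integrable_cong[OF x''])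

  assume small: "2 * l\<^sup>2 * L\<^sup>2 + 2 * l * \<mu> \<le> 1"
  define Z where "Z \<omega> = (2 * l\<^sup>2) *\<^sub>R (B (y \<omega>) - r \<omega>) - (2 * l) *\<^sub>R (y \<omega> - p)" for \<omega>
  have Z: "square_integrable M Z" unfolding Z_def
    by (intro square_integrable_diff square_integrable_scaleR R
        square_integrable_lipschitz[OF fin B Y] Yp)
  have ZF: "Z \<in> borel_measurable F" unfolding Z_def by measurable
  note prod = integrable_norm_mult_norm[OF sB Z]
  have cross: "expectation (\<lambda>\<omega>. inner (s \<omega> - B (y \<omega>)) (Z \<omega>)) = 0"
    by (rule is_cond_exp_orthogonal[OF ce ZF prod])
  have crossint: "integrable M (\<lambda>\<omega>. inner (s \<omega> - B (y \<omega>)) (Z \<omega>))"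
  proof (rule Bochner_Integration.integrable_bound[OF prod])
    show "(\<lambda>\<omega>. inner (s \<omega> - B (y \<omega>)) (Z \<omega>)) \<in> borel_measurable M"
      using Z by (auto simp: square_integrable_def)
  qed (auto intro!: AE_I2 Cauchy_Schwarz_ineq2)
  have Wp: "square_integrable M (\<lambda>\<omega>. w \<omega> - p)" and Xp: "square_integrable M (\<lambda>\<omega>. x \<omega> - p)"
    and X''p: "square_integrable M (\<lambda>\<omega>. x'' \<omega> - p)"
    by (intro square_integrable_diff W x X'' square_integrable_const)+
  have ints: "integrable M (\<lambda>\<omega>. (norm (w \<omega> - p))\<^sup>2)" "integrable M (\<lambda>\<omega>. (norm (x'' \<omega> - p))\<^sup>2)"
    using Wp X''p by (auto simp: square_integrable_def)
  have pw: "(norm (x'' \<omega> - p))\<^sup>2 \<le> (1 - l * \<mu>) * (norm (w \<omega> - p))\<^sup>2 + l\<^sup>2 * G \<omega>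
      + inner (s \<omega> - B (y \<omega>)) (Z \<omega>)" if \<omega>: "\<omega> \<in> space M" for \<omega>
  proof -
    obtain u where u: "u \<in> A (y \<omega>)" "w \<omega> - l *\<^sub>R r \<omega> = y \<omega> + l *\<^sub>R u"
      using y[OF \<omega>] by (rule resolventE)
    show ?thesis unfolding G_def Z_def
      by (rule fbf_step_estimate[OF B strongly_monotone_sum[OF mono strong u(1)] par(3) \<mu> small
            u(2) x''[OF \<omega>]]) (use p in \<open>simp add: mem_zeros_sum_iff\<close>)
  qed
  have "expectation (\<lambda>\<omega>. (norm (x'' \<omega> - p))\<^sup>2) \<le> expectation (\<lambda>\<omega>.
      (1 - l * \<mu>) * (norm (w \<omega> - p))\<^sup>2 + l\<^sup>2 * G \<omega> + inner (s \<omega> - B (y \<omega>)) (Z \<omega>))"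
    using ints G(1) crossint pw by (intro integral_mono) auto
  also have "\<dots> = (1 - l * \<mu>) * expectation (\<lambda>\<omega>. (norm (w \<omega> - p))\<^sup>2) + l\<^sup>2 * expectation G"
    using ints G(1) crossint cross by simp
  also have "\<dots> \<le> (1 - l * \<mu>) * ((1 + e) * expectation (\<lambda>\<omega>. (norm (x \<omega> - p))\<^sup>2) + e + e\<^sup>2)
      + l\<^sup>2 * max c 0"
  proof (intro add_mono mult_left_mono)
    show "expectation (\<lambda>\<omega>. (norm (w \<omega> - p))\<^sup>2)
        \<le> (1 + e) * expectation (\<lambda>\<omega>. (norm (x \<omega> - p))\<^sup>2) + e + e\<^sup>2"
      by (rule expectation_norm_add_le[OF Xp Wp]) (simp add: disp)
    have "0 \<le> 2 * l\<^sup>2 * L\<^sup>2" "0 < l * \<mu>" using par \<mu> by auto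
    thus "0 \<le> 1 - l * \<mu>" using small by linarith
  qed (use G in auto)
  finally show "expectation (\<lambda>\<omega>. (norm (x'' \<omega> - p))\<^sup>2)
      \<le> (1 - l * \<mu>) * ((1 + e) * expectation (\<lambda>\<omega>. (norm (x \<omega> - p))\<^sup>2) + e + e\<^sup>2)
      + l\<^sup>2 * max c 0" .
qed

lemma measurable_sigma_generated:
  fixes X :: "'w \<Rightarrow> 'a::topological_space"
  assumes "X \<in> Xs"
  shows "X \<in> measurable (sigma_generated M Xs) borel"
proof (rule measurableI)
  fix S :: "'a set" assume "S \<in> sets borel"
  thus "X -` S \<inter> space (sigma_generated M Xs) \<in> sets (sigma_generated M Xs)"
    unfolding sigma_generated_def using assms by (auto simp: space_measure_of_conv)
qed simp

theorem theorem3p8: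
  fixes M :: "'w measure"
    and A :: "'a::{real_inner, banach, second_countable_topology} \<Rightarrow> 'a set"
    and B :: "'a \<Rightarrow> 'a"
    and L \<mu> \<alpha> a c \<theta> \<theta>bar \<beta> :: real
    and lam \<epsilon> :: "nat \<Rightarrow> real"
    and p :: 'a
    and xm :: "'w \<Rightarrow> 'a"
    and x r s w y :: "nat \<Rightarrow> 'w \<Rightarrow> 'a"
    and wt :: "nat \<Rightarrow> 'w \<Rightarrow> real"
  assumes "prob_space M"
    and "L > 0" and "L-lipschitz_on UNIV B" and "monotone_operator (\<lambda>z. {B z})"
    and "maximally_monotone A"
    and "\<mu> > 0" and "strongly_monotone \<mu> A \<or> strongly_monotone \<mu> (\<lambda>z. {B z})"
    and "p \<in> zeros_sum A B"
    and "1/2 < \<alpha>" and "\<alpha> \<le> 1" and "a > 0"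
    and "0 \<le> \<theta>bar" and "\<theta>bar \<le> 1"
    and "\<And>n. lam n > 0" and "\<And>n. n \<ge> 1 \<Longrightarrow> lam n = 4 * a / (\<mu> * real n powr \<alpha>)"
    and "\<And>n. \<epsilon> n \<ge> 0" and "summable \<epsilon>"
    and "xm \<in> borel_measurable M" and "integrable M (\<lambda>\<omega>. (norm (xm \<omega>))\<^sup>2)"
    and "x 0 \<in> borel_measurable M" and "integrable M (\<lambda>\<omega>. (norm (x 0 \<omega>))\<^sup>2)"
    and "\<And>n. r n \<in> borel_measurable M" and "\<And>n. s n \<in> borel_measurable M"
    and "\<And>n \<omega>. \<omega> \<in> space M \<Longrightarrow> wt n \<omega> = inertial_weight \<theta>bar (\<epsilon> n) (x n \<omega>) (prev xm x n \<omega>)"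
    and "\<And>n \<omega>. \<omega> \<in> space M \<Longrightarrow> w n \<omega> = x n \<omega> + wt n \<omega> *\<^sub>R (x n \<omega> - prev xm x n \<omega>)"
    and "\<And>n \<omega>. \<omega> \<in> space M \<Longrightarrow> y n \<omega> \<in> resolvent A (lam n) (w n \<omega> - lam n *\<^sub>R r n \<omega>)"
    and "\<And>n. is_cond_exp M (fbf_history M xm x r n) (s n) (\<lambda>\<omega>. B (y n \<omega>))"
    and "\<And>n \<omega>. \<omega> \<in> space M \<Longrightarrow> x (Suc n) \<omega> = y n \<omega> - lam n *\<^sub>R (s n \<omega> - r n \<omega>)"
    and "\<And>n. AE \<omega> in M. nn_cond_exp M (fbf_history M xm x r n)
           (\<lambda>\<omega>. ennreal (2 * (norm (r n \<omega> - B (w n \<omega>)))\<^sup>2 + (norm (s n \<omega> - B (y n \<omega>)))\<^sup>2)) \<omega>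
             \<le> ennreal c"
    and "\<theta> > 1" and "\<epsilon> \<in> O(\<lambda>n. real n powr (- \<theta>))"
    and "\<beta> = min (2 * \<alpha>) \<theta>" and "a \<le> \<beta>"
  shows "zeros_sum A B = {p} \<and>
    (\<forall>n. integrable M (\<lambda>\<omega>. (norm (x n \<omega> - p))\<^sup>2)) \<and>
    (let e = (\<lambda>n. prob_space.expectation M (\<lambda>\<omega>. (norm (x n \<omega> - p))\<^sup>2)) in
      (\<alpha> < 1 \<longrightarrow> e \<in> O(\<lambda>n. real n powr (\<alpha> - \<beta>))) \<and>
      (\<alpha> = 1 \<and> a \<noteq> \<beta> - 1 \<longrightarrow>
        (\<exists>f\<in>O(\<lambda>n. real n powr (- a)). \<exists>g\<in>O(\<lambda>n. real n powr (1 - \<beta>)).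
          \<forall>n. e n = f n + g n)) \<and>
      (\<alpha> = 1 \<and> a = \<beta> - 1 \<longrightarrow>
        (\<exists>f\<in>O(\<lambda>n. real n powr (- a)). \<exists>g\<in>O(\<lambda>n. ln (real n) / real n powr a).
          \<forall>n. e n = f n + g n)))"
proof -
  note as = assms
  interpret prob_space M by (rule as(1))
  have mono: "monotone_operator A" using as(5) by (simp add: maximally_monotone_def)
  let ?F = "\<lambda>n. fbf_history M xm x r n"
  have xF: "x n \<in> borel_measurable (?F n)" and rF: "r n \<in> borel_measurable (?F n)" for n
    unfolding fbf_history_def by (rule measurable_sigma_generated, simp)+
  have pF: "prev xm x n \<in> borel_measurable (?F n)" for n
    unfolding fbf_history_def prev_def
    by (rule measurable_sigma_generated) (auto split: nat.split)
  have weq: "w n \<omega> = x n \<omega> + inertial_weight \<theta>bar (\<epsilon> n) (x n \<omega>) (prev xm x n \<omega>)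
      *\<^sub>R (x n \<omega> - prev xm x n \<omega>)" if "\<omega> \<in> space M" for n \<omega>
    using as(24,25)[OF that] by simp
  note step = fbf_step_expectation[OF as(1,3) mono as(4,7,6,8,12) as(16) as(14) xF pF rF as(23)
      _ weq as(26) as(27) as(28) as(29)]
  have X: "square_integrable M (x n)" for n
  proof (induction n)
    case 0
    show ?case using as(20,21) by (simp add: square_integrable_def)
  next
    case (Suc n)
    show ?case by (rule step(1)[OF Suc])
  qed
  define e where "e n = expectation (\<lambda>\<omega>. (norm (x n \<omega> - p))\<^sup>2)" for n
  have e0: "e n \<ge> 0" for n by (simp add: e_def)
  define t where "t n = real n powr (- \<alpha>)" for n
  have lam: "lam n = (4 * a / \<mu>) * t n" if "n \<ge> 1" for n
    using as(15)[OF that] by (simp add: t_def powr_minus field_simps)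
  obtain K where K: "K > 0" "eventually (\<lambda>n. norm (\<epsilon> n) \<le> K * norm (real n powr (- \<theta>))) sequentially"
    using as(31) by (elim landau_o.bigE)
  define C where "C = 2 * K + (4 * a / \<mu>)\<^sup>2 * max c 0"
  have C0: "C \<ge> 0" using K by (simp add: C_def)
  have t0: "t \<longlonglongrightarrow> 0" unfolding t_def
    using as(9) by (intro tendsto_neg_powr filterlim_real_sequentially) auto
  have "(\<lambda>n. 2 * ((4 * a / \<mu>) * t n)\<^sup>2 * L\<^sup>2 + 2 * ((4 * a / \<mu>) * t n) * \<mu>) \<longlonglongrightarrow>
      2 * ((4 * a / \<mu>) * 0)\<^sup>2 * L\<^sup>2 + 2 * ((4 * a / \<mu>) * 0) * \<mu>"
    by (intro tendsto_intros t0)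
  hence ev1: "eventually (\<lambda>n. 2 * ((4 * a / \<mu>) * t n)\<^sup>2 * L\<^sup>2 + 2 * ((4 * a / \<mu>) * t n) * \<mu> < 1) sequentially"
    by (intro order_tendstoD(2)) auto
  have "(\<lambda>n. real n powr (- (\<theta> - \<alpha>))) \<longlonglongrightarrow> 0"
    using as(10,30) by (intro tendsto_neg_powr filterlim_real_sequentially) auto
  hence ev2: "eventually (\<lambda>n. real n powr (- (\<theta> - \<alpha>)) < a / K) sequentially"
    using as(11) K by (intro order_tendstoD(2)) auto
  have rec: "eventually (\<lambda>n. e (Suc n) \<le> (1 - 2 * a * real n powr (- \<alpha>)) * e n
      + C * real n powr (- \<beta>)) sequentially"
    using ev1 ev2 K(2) eventually_ge_at_top[of 1]
  proof eventually_elim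
    case (elim n)
    have tn: "t n > 0" using elim by (simp add: t_def)
    have l: "lam n * \<mu> = 4 * (a * t n)" using lam[OF elim(4)] as(6) by simp
    have step_size: "2 * (lam n)\<^sup>2 * L\<^sup>2 + 2 * lam n * \<mu> \<le> 1" using elim lam by simp
    have at0: "a * t n > 0" using tn as(11) by simp
    have "0 \<le> 2 * (lam n)\<^sup>2 * L\<^sup>2" by simp
    hence at: "4 * (a * t n) \<le> 1" using step_size l at0 by linarith
    have eps: "0 \<le> \<epsilon> n" "\<epsilon> n \<le> K * real n powr (- \<theta>)" using elim(3) as(16)[of n] by auto
    have "K * real n powr (- \<theta>) = K * real n powr (- (\<theta> - \<alpha>)) * t n"
      by (simp add: t_def powr_add[symmetric])
    also have "\<dots> \<le> a * t n"
      using elim(2) K tn by (intro mult_right_mono) (auto simp: field_simps)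
    finally have epst: "\<epsilon> n \<le> a * t n" using eps by simp
    have pw: "real n powr (- \<theta>) \<le> real n powr (- \<beta>)" "(t n)\<^sup>2 \<le> real n powr (- \<beta>)"
    proof -
      show "real n powr (- \<theta>) \<le> real n powr (- \<beta>)"
        using elim(4) as(32) by (intro powr_mono) auto
      have "(t n)\<^sup>2 = real n powr (- (2 * \<alpha>))"
        using elim(4) by (simp add: t_def power2_eq_square powr_add[symmetric])
      also have "\<dots> \<le> real n powr (- \<beta>)" using elim(4) as(32) by (intro powr_mono) auto
      finally show "(t n)\<^sup>2 \<le> real n powr (- \<beta>)" .
    qed
    have "(1 - 4 * (a * t n)) * (1 + \<epsilon> n) \<le> (1 - 4 * (a * t n)) * (1 + a * t n)"
      using at epst by (intro mult_left_mono) auto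
    also have "\<dots> = 1 - 3 * (a * t n) - 4 * (a * t n)\<^sup>2"
      by (simp add: algebra_simps power2_eq_square)
    also have "\<dots> \<le> 1 - 2 * (a * t n)" using at0 zero_le_power2[of "a * t n"] by linarith
    finally have c1: "(1 - 4 * (a * t n)) * (1 + \<epsilon> n) * e n \<le> (1 - 2 * (a * t n)) * e n"
      using e0 by (intro mult_right_mono) auto
    have "\<epsilon> n * \<epsilon> n \<le> \<epsilon> n * 1" using eps epst at by (intro mult_left_mono) auto
    hence "\<epsilon> n + (\<epsilon> n)\<^sup>2 \<le> 2 * \<epsilon> n" by (simp add: power2_eq_square)
    moreover have "K * real n powr (- \<theta>) \<le> K * real n powr (- \<beta>)"
      using pw K by (intro mult_left_mono) auto
    ultimately have e2: "\<epsilon> n + (\<epsilon> n)\<^sup>2 \<le> 2 * (K * real n powr (- \<beta>))"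
      using eps by linarith
    have "(1 - 4 * (a * t n)) * (\<epsilon> n + (\<epsilon> n)\<^sup>2) \<le> 1 * (\<epsilon> n + (\<epsilon> n)\<^sup>2)"
      using at0 eps by (intro mult_right_mono) auto
    with e2 have c2: "(1 - 4 * (a * t n)) * (\<epsilon> n + (\<epsilon> n)\<^sup>2) \<le> 2 * (K * real n powr (- \<beta>))"
      by simp
    have "(lam n)\<^sup>2 * max c 0 = ((4 * a / \<mu>)\<^sup>2 * max c 0) * (t n)\<^sup>2"
      unfolding lam[OF elim(4)] power_mult_distrib by (simp only: mult_ac)
    also have "\<dots> \<le> ((4 * a / \<mu>)\<^sup>2 * max c 0) * real n powr (- \<beta>)"
      using pw by (intro mult_left_mono) auto
    finally have c3: "(lam n)\<^sup>2 * max c 0 \<le> ((4 * a / \<mu>)\<^sup>2 * max c 0) * real n powr (- \<beta>)" .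
    have "e (Suc n) \<le> (1 - 4 * (a * t n)) * ((1 + \<epsilon> n) * e n + \<epsilon> n + (\<epsilon> n)\<^sup>2) + (lam n)\<^sup>2 * max c 0"
      unfolding e_def l[symmetric] by (rule step(2)[OF X _ _ _ step_size])
    also have "\<dots> = (1 - 4 * (a * t n)) * (1 + \<epsilon> n) * e n + (1 - 4 * (a * t n)) * (\<epsilon> n + (\<epsilon> n)\<^sup>2)
        + (lam n)\<^sup>2 * max c 0"
      by (simp add: algebra_simps)
    also have "\<dots> \<le> (1 - 2 * (a * t n)) * e n + 2 * (K * real n powr (- \<beta>))
        + ((4 * a / \<mu>)\<^sup>2 * max c 0) * real n powr (- \<beta>)"
      by (intro add_mono c1 c2 c3)
    finally show ?case by (simp add: C_def t_def algebra_simps)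
  qed
  have rate: "e \<in> O(\<lambda>n. real n powr (- q))" if q: "q \<ge> 0" "q + \<alpha> \<le> \<beta>"
    and slow: "eventually (\<lambda>n. q / real n \<le> a * real n powr (- \<alpha>)) sequentially" for q
    by (rule chung_recursion_bigo[OF e0 as(11) _ q C0 slow rec]) (use as(9) in simp)
  have sub: "e \<in> O(\<lambda>n. real n powr (\<alpha> - \<beta>))" if "\<alpha> < 1"
  proof -
    have "(\<lambda>n. real n powr (- (1 - \<alpha>))) \<longlonglongrightarrow> 0"
      using that by (intro tendsto_neg_powr filterlim_real_sequentially) auto
    from tendsto_mult_left[OF this, of "\<beta> - \<alpha>"]
    have "(\<lambda>n. (\<beta> - \<alpha>) * real n powr (- (1 - \<alpha>))) \<longlonglongrightarrow> 0" by simp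
    hence "eventually (\<lambda>n. (\<beta> - \<alpha>) * real n powr (- (1 - \<alpha>)) < a) sequentially"
      using as(11) by (intro order_tendstoD(2)) auto
    hence slow: "eventually (\<lambda>n. (\<beta> - \<alpha>) / real n \<le> a * real n powr (- \<alpha>)) sequentially"
      using eventually_ge_at_top[of 1]
    proof eventually_elim
      case (elim n)
      have "(\<beta> - \<alpha>) / real n = (\<beta> - \<alpha>) * real n powr (- (1 - \<alpha>)) * real n powr (- \<alpha>)"
        unfolding mult.assoc powr_add[symmetric] using elim(2) by (simp add: powr_minus divide_inverse)
      also have "\<dots> \<le> a * real n powr (- \<alpha>)" using elim(1) by (intro mult_right_mono) auto
      finally show ?case .
    qed
    show ?thesis using rate[of "\<beta> - \<alpha>"] slow as(9,30,32) that by (simp add: min_def)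
  qed
  have lin: "e \<in> O(\<lambda>n. real n powr (- q))" if "\<alpha> = 1" "q \<ge> 0" "q \<le> a" "q \<le> \<beta> - 1" for q
  proof (rule rate)
    show "eventually (\<lambda>n. q / real n \<le> a * real n powr (- \<alpha>)) sequentially"
      using eventually_ge_at_top[of 1]
      by eventually_elim (use that in \<open>simp add: powr_minus field_simps\<close>)
  qed (use that in auto)
  have \<beta>1: "\<beta> > 1" using as(9,30,32) by auto
  \<comment> \<open>The contraction factor \<open>1 - 2 a / n\<close> beats \<open>n powr - a\<close> strictly, so the logarithm never
    occurs.\<close>
  have small: "\<exists>f\<in>O(\<lambda>n. real n powr (- a)). \<exists>g\<in>O(h). \<forall>n. e n = f n + g n"
    if "\<alpha> = 1" "a \<le> \<beta> - 1" for h :: "nat \<Rightarrow> real"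
    using lin[of a] that as(11) by (intro bexI[of _ e] bexI[of _ "\<lambda>_. 0"]) auto
  have large: "\<exists>f\<in>O(\<lambda>n. real n powr (- a)). \<exists>g\<in>O(\<lambda>n. real n powr (1 - \<beta>)). \<forall>n. e n = f n + g n"
    if "\<alpha> = 1" "a > \<beta> - 1"
    using lin[of "\<beta> - 1"] that \<beta>1 by (intro bexI[of _ "\<lambda>_. 0"] bexI[of _ e]) auto
  have integrable: "integrable M (\<lambda>\<omega>. (norm (x n \<omega> - p))\<^sup>2)" for n
    using square_integrable_diff[OF X square_integrable_const] by (simp add: square_integrable_def)
  show ?thesis
    unfolding Let_def e_def[abs_def, symmetric]
  proof (intro conjI allI impI; (elim conjE)?)
    show "zeros_sum A B = {p}" by (rule zeros_sum_eq_singleton[OF mono as(4,6,7,8)])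
    show "\<exists>f\<in>O(\<lambda>n. real n powr (- a)). \<exists>g\<in>O(\<lambda>n. real n powr (1 - \<beta>)). \<forall>n. e n = f n + g n"
      if "\<alpha> = 1"
      using small[OF that] large[OF that] by (cases "a \<le> \<beta> - 1") (simp_all add: not_le)
  qed (use integrable sub small in auto)
qed

end
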